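(* Let $\mathcal{E}$ be a finitely complete and cocomplete category with two weak factorization systems $(\mathbf{C}, \mathbf{TF})$ and $(\mathbf{TC}, \mathbf{F})$ such that $\mathbf{TC} \subseteq \mathbf{C}$ (equivalently $\mathbf{TF} \subseteq \mathbf{F}$). Let $\mathbf{W}$ be the class of maps that factor as a map in $\mathbf{TC}$ followed by a map in $\mathbf{TF}$. Assume: (i) the span property holds; (ii) trivial fibrations satisfy 2-out-of-3 relative to fibrations; (iii) fibrations extend along trivial cofibrations, and trivial fibrations extend along trivial cofibrations; (iv) the weak factorization system $(\mathbf{TC}, \mathbf{F})$ satisfies the Frobenius property. Then $(\mathbf{C}, \mathbf{W}, \mathbf{F})$ forms a right proper model structure on $\mathcal{E}$.
   Context: Maps in $\mathbf{C}$, $\mathbf{TC}$, $\mathbf{F}$, $\mathbf{TF}$ are called cofibrations, trivial cofibrations, fibrations, trivial fibrations respectively. Model structure: three classes of maps $\mathbf{C}, \mathbf{W}, \mathbf{F}$ such that $(\mathbf{C}, \mathbf{F} \cap \mathbf{W})$ and $(\mathbf{C} \cap \mathbf{W}, \mathbf{F})$ are weak factorization systems and $\mathbf{W}$ satisfies 2-out-of-3 (factorizations are not required to be functorial). It is right proper if $\mathbf{W}$ is stable under pullback along maps in $\mathbf{F}$. Span property: for any trivial cofibrations $a \colon A \to Y$ and $b \colon A \to X$ and any fibration $p \colon Y \to X$ with $p a = b$, the map $p$ is a trivial fibration. 2-out-of-3 of trivial fibrations relative to fibrations: for fibrations $p \colon Z \to Y$, $q \colon Y \to X$ (so that $qp$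 is also a fibration), if two of $p$, $q$, $qp$ are trivial fibrations then so is the third. Extension: a class of maps $\mathbf{B}$ extends along a class of maps $\mathbf{A}$ if for all $f \colon X \to A$ in $\mathbf{B}$ and $m \colon A \to B$ in $\mathbf{A}$ there are $g \colon Y \to B$ in $\mathbf{B}$ and $n \colon X \to Y$ such that $g n = m f$ and this square is a pullback. Frobenius property of $(\mathbf{TC}, \mathbf{F})$: maps in $\mathbf{TC}$ are preserved under pullback along maps in $\mathbf{F}$. *)

theory Defs
  imports Main
begin

text \<open>
  Categories are given by carrier sets of objects and morphisms; values of the operations
  outside these carriers, and of composition at non-composable pairs, are unconstrained.
  Composition is in applicative order. A class of maps is a subset of \<open>Mor E\<close>.
\<close>

record ('o, 'm) cat =
  Obj :: "'o set"
  Mor :: "'m set"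
  Dom :: "'m \<Rightarrow> 'o"
  Cod :: "'m \<Rightarrow> 'o"
  Ident :: "'o \<Rightarrow> 'm"
  Comp :: "'m \<Rightarrow> 'm \<Rightarrow> 'm"  (infixr "\<cdot>\<index>" 70)

definition Hom :: "('o, 'm) cat \<Rightarrow> 'o \<Rightarrow> 'o \<Rightarrow> 'm set" where
  "Hom E X Y = {f \<in> Mor E. Dom E f = X \<and> Cod E f = Y}"

locale category =
  fixes E :: "('o, 'm) cat"  (structure)
  assumes dom_obj: "f \<in> Mor E \<Longrightarrow> Dom E f \<in> Obj E"
    and cod_obj: "f \<in> Mor E \<Longrightarrow> Cod E f \<in> Obj E"
    and ident_hom: "X \<in> Obj E \<Longrightarrow> Ident E X \<in> Hom E X X"
    and comp_hom: "\<lbrakk>f \<in> Hom E X Y; g \<in> Hom E Y Z\<rbrakk> \<Longrightarrow> g \<cdot> f \<in> Hom E X Z"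
    and comp_ident_right: "f \<in> Hom E X Y \<Longrightarrow> f \<cdot> Ident E X = f"
    and comp_ident_left: "f \<in> Hom E X Y \<Longrightarrow> Ident E Y \<cdot> f = f"
    and comp_assoc: "\<lbrakk>f \<in> Hom E W X; g \<in> Hom E X Y; h \<in> Hom E Y Z\<rbrakk>
      \<Longrightarrow> (h \<cdot> g) \<cdot> f = h \<cdot> (g \<cdot> f)"


section \<open>Finite limits and colimits\<close>

definition is_functor ::
  "('j, 'k) cat \<Rightarrow> ('o, 'm) cat \<Rightarrow> ('j \<Rightarrow> 'o) \<Rightarrow> ('k \<Rightarrow> 'm) \<Rightarrow> bool" where
  "is_functor J E Do Dm \<longleftrightarrow>
     category J \<and> category E \<and>
     (\<forall>j\<in>Obj J. Do j \<in> Obj E) \<and>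
     (\<forall>k\<in>Mor J. Dm k \<in> Hom E (Do (Dom J k)) (Do (Cod J k))) \<and>
     (\<forall>j\<in>Obj J. Dm (Ident J j) = Ident E (Do j)) \<and>
     (\<forall>k\<in>Mor J. \<forall>l\<in>Mor J. Cod J k = Dom J l \<longrightarrow> Dm (l \<cdot>\<^bsub>J\<^esub> k) = Dm l \<cdot>\<^bsub>E\<^esub> Dm k)"

definition is_cone ::
  "('j, 'k) cat \<Rightarrow> ('o, 'm) cat \<Rightarrow> ('j \<Rightarrow> 'o) \<Rightarrow> ('k \<Rightarrow> 'm) \<Rightarrow> 'o \<Rightarrow> ('j \<Rightarrow> 'm) \<Rightarrow> bool" where
  "is_cone J E Do Dm X c \<longleftrightarrow>
     X \<in> Obj E \<and>
     (\<forall>j\<in>Obj J. c j \<in> Hom E X (Do j)) \<and>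
     (\<forall>k\<in>Mor J. Dm k \<cdot>\<^bsub>E\<^esub> c (Dom J k) = c (Cod J k))"

definition is_limit ::
  "('j, 'k) cat \<Rightarrow> ('o, 'm) cat \<Rightarrow> ('j \<Rightarrow> 'o) \<Rightarrow> ('k \<Rightarrow> 'm) \<Rightarrow> 'o \<Rightarrow> ('j \<Rightarrow> 'm) \<Rightarrow> bool" where
  "is_limit J E Do Dm L c \<longleftrightarrow>
     is_cone J E Do Dm L c \<and>
     (\<forall>X d. is_cone J E Do Dm X d \<longrightarrow>
        (\<exists>!u. u \<in> Hom E X L \<and> (\<forall>j\<in>Obj J. c j \<cdot>\<^bsub>E\<^esub> u = d j)))"

definition is_cocone ::
  "('j, 'k) cat \<Rightarrow> ('o, 'm) cat \<Rightarrow> ('j \<Rightarrow> 'o) \<Rightarrow> ('k \<Rightarrow> 'm) \<Rightarrow> 'o \<Rightarrow> ('j \<Rightarrow> 'm) \<Rightarrow> bool" where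
  "is_cocone J E Do Dm X c \<longleftrightarrow>
     X \<in> Obj E \<and>
     (\<forall>j\<in>Obj J. c j \<in> Hom E (Do j) X) \<and>
     (\<forall>k\<in>Mor J. c (Cod J k) \<cdot>\<^bsub>E\<^esub> Dm k = c (Dom J k))"

definition is_colimit ::
  "('j, 'k) cat \<Rightarrow> ('o, 'm) cat \<Rightarrow> ('j \<Rightarrow> 'o) \<Rightarrow> ('k \<Rightarrow> 'm) \<Rightarrow> 'o \<Rightarrow> ('j \<Rightarrow> 'm) \<Rightarrow> bool" where
  "is_colimit J E Do Dm L c \<longleftrightarrow>
     is_cocone J E Do Dm L c \<and>
     (\<forall>X d. is_cocone J E Do Dm X d \<longrightarrow>
        (\<exists>!u. u \<in> Hom E L X \<and> (\<forall>j\<in>Obj J. u \<cdot>\<^bsub>E\<^esub> c j = d j)))"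

text \<open>
  Since every finite category is isomorphic to one whose objects and morphisms are natural
  numbers, it suffices to let the shapes range over \<open>(nat, nat) cat\<close>. The empty shape is included.
\<close>

definition finitely_complete :: "('o, 'm) cat \<Rightarrow> bool" where
  "finitely_complete E \<longleftrightarrow>
     (\<forall>(J :: (nat, nat) cat) Do Dm.
        finite (Obj J) \<and> finite (Mor J) \<and> is_functor J E Do Dm \<longrightarrow>
        (\<exists>L c. is_limit J E Do Dm L c))"

definition finitely_cocomplete :: "('o, 'm) cat \<Rightarrow> bool" where
  "finitely_cocomplete E \<longleftrightarrow>
     (\<forall>(J :: (nat, nat) cat) Do Dm.
        finite (Obj J) \<and> finite (Mor J) \<and> is_functor J E Do Dm \<longrightarrow>
        (\<exists>L c. is_colimit J E Do Dm L c))"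

text \<open>
  \<open>is_pullback E p q f g\<close>: the square
  \<open>f \<cdot> p = g \<cdot> q\<close> with \<open>p : P \<rightarrow> A\<close>, \<open>q : P \<rightarrow> B\<close>, \<open>f : A \<rightarrow> D\<close>, \<open>g : B \<rightarrow> D\<close> is a pullback, so
  \<open>p\<close> is a pullback of \<open>g\<close> along \<open>f\<close>, and \<open>q\<close> is a pullback of \<open>f\<close> along \<open>g\<close>.
\<close>

definition is_pullback :: "('o, 'm) cat \<Rightarrow> 'm \<Rightarrow> 'm \<Rightarrow> 'm \<Rightarrow> 'm \<Rightarrow> bool" where
  "is_pullback E p q f g \<longleftrightarrow>
     {p, q, f, g} \<subseteq> Mor E \<and>
     Dom E p = Dom E q \<and> Cod E p = Dom E f \<and> Cod E q = Dom E g \<and> Cod E f = Cod E g \<and>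
     f \<cdot>\<^bsub>E\<^esub> p = g \<cdot>\<^bsub>E\<^esub> q \<and>
     (\<forall>T. \<forall>s \<in> Hom E T (Dom E f). \<forall>t \<in> Hom E T (Dom E g).
        f \<cdot>\<^bsub>E\<^esub> s = g \<cdot>\<^bsub>E\<^esub> t \<longrightarrow>
        (\<exists>!u. u \<in> Hom E T (Dom E p) \<and> p \<cdot>\<^bsub>E\<^esub> u = s \<and> q \<cdot>\<^bsub>E\<^esub> u = t))"


section \<open>Weak factorization systems and model structures\<close>

definition lifts_against :: "('o, 'm) cat \<Rightarrow> 'm \<Rightarrow> 'm \<Rightarrow> bool" where
  "lifts_against E i p \<longleftrightarrow>
     (\<forall>u \<in> Hom E (Dom E i) (Dom E p). \<forall>v \<in> Hom E (Cod E i) (Cod E p).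
        p \<cdot>\<^bsub>E\<^esub> u = v \<cdot>\<^bsub>E\<^esub> i \<longrightarrow>
        (\<exists>h \<in> Hom E (Cod E i) (Dom E p). h \<cdot>\<^bsub>E\<^esub> i = u \<and> p \<cdot>\<^bsub>E\<^esub> h = v))"

definition left_lifting_class :: "('o, 'm) cat \<Rightarrow> 'm set \<Rightarrow> 'm set" where
  "left_lifting_class E R = {i \<in> Mor E. \<forall>p\<in>R. lifts_against E i p}"

definition right_lifting_class :: "('o, 'm) cat \<Rightarrow> 'm set \<Rightarrow> 'm set" where
  "right_lifting_class E L = {p \<in> Mor E. \<forall>i\<in>L. lifts_against E i p}"

definition factor_class :: "('o, 'm) cat \<Rightarrow> 'm set \<Rightarrow> 'm set \<Rightarrow> 'm set" where
  \<comment> \<open>maps that factor as a map in \<open>L\<close> followed by a map in \<open>R\<close>\<close>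
  "factor_class E L R =
     {f \<in> Mor E. \<exists>i \<in> L \<inter> Mor E. \<exists>p \<in> R \<inter> Mor E. Cod E i = Dom E p \<and> f = p \<cdot>\<^bsub>E\<^esub> i}"

definition weak_factorization_system :: "('o, 'm) cat \<Rightarrow> 'm set \<Rightarrow> 'm set \<Rightarrow> bool" where
  "weak_factorization_system E L R \<longleftrightarrow>
     L = left_lifting_class E R \<and> R = right_lifting_class E L \<and> Mor E \<subseteq> factor_class E L R"

definition two_out_of_three_relative :: "('o, 'm) cat \<Rightarrow> 'm set \<Rightarrow> 'm set \<Rightarrow> bool" where
  "two_out_of_three_relative E S F \<longleftrightarrow>
     (\<forall>p \<in> F. \<forall>q \<in> F. Cod E p = Dom E q \<longrightarrow>
        (p \<in> S \<and> q \<in> S \<longrightarrow> q \<cdot>\<^bsub>E\<^esub> p \<in> S) \<and>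
        (p \<in> S \<and> q \<cdot>\<^bsub>E\<^esub> p \<in> S \<longrightarrow> q \<in> S) \<and>
        (q \<in> S \<and> q \<cdot>\<^bsub>E\<^esub> p \<in> S \<longrightarrow> p \<in> S))"

abbreviation two_out_of_three :: "('o, 'm) cat \<Rightarrow> 'm set \<Rightarrow> bool" where
  "two_out_of_three E W \<equiv> two_out_of_three_relative E W (Mor E)"

definition stable_under_pullback_along :: "('o, 'm) cat \<Rightarrow> 'm set \<Rightarrow> 'm set \<Rightarrow> bool" where
  "stable_under_pullback_along E S F \<longleftrightarrow>
     (\<forall>p q f g. is_pullback E p q f g \<and> f \<in> F \<and> g \<in> S \<longrightarrow> p \<in> S)"

definition model_structure :: "('o, 'm) cat \<Rightarrow> 'm set \<Rightarrow> 'm set \<Rightarrow> 'm set \<Rightarrow> bool" where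
  "model_structure E C W F \<longleftrightarrow>
     C \<subseteq> Mor E \<and> W \<subseteq> Mor E \<and> F \<subseteq> Mor E \<and>
     weak_factorization_system E C (F \<inter> W) \<and>
     weak_factorization_system E (C \<inter> W) F \<and>
     two_out_of_three E W"

definition right_proper_model_structure ::
  "('o, 'm) cat \<Rightarrow> 'm set \<Rightarrow> 'm set \<Rightarrow> 'm set \<Rightarrow> bool" where
  "right_proper_model_structure E C W F \<longleftrightarrow>
     model_structure E C W F \<and> stable_under_pullback_along E W F"

definition span_property :: "('o, 'm) cat \<Rightarrow> 'm set \<Rightarrow> 'm set \<Rightarrow> 'm set \<Rightarrow> bool" where
  "span_property E TC F TF \<longleftrightarrow>
     (\<forall>A X Y. \<forall>a \<in> TC \<inter> Hom E A Y. \<forall>b \<in> TC \<inter> Hom E A X. \<forall>p \<in> F \<inter> Hom E Y X.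
        p \<cdot>\<^bsub>E\<^esub> a = b \<longrightarrow> p \<in> TF)"

definition extends_along :: "('o, 'm) cat \<Rightarrow> 'm set \<Rightarrow> 'm set \<Rightarrow> bool" where
  "extends_along E BB AA \<longleftrightarrow>
     (\<forall>X A B. \<forall>f \<in> BB \<inter> Hom E X A. \<forall>m \<in> AA \<inter> Hom E A B.
        \<exists>Y. \<exists>g \<in> BB \<inter> Hom E Y B. \<exists>n \<in> Hom E X Y. is_pullback E n f g m)"

definition frobenius_property :: "('o, 'm) cat \<Rightarrow> 'm set \<Rightarrow> 'm set \<Rightarrow> bool" where
  "frobenius_property E TC F \<longleftrightarrow> stable_under_pullback_along E TC F"

end

theory Submission
  imports Defs
begin

text \<open>
  The hard axiom is 2-out-of-3 for the weak equivalences \<open>W\<close>, and the proof reduces it to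
  2-out-of-3 for trivial fibrations among fibrations.

  First, \<open>W\<close> can be tested on any factorization: if \<open>p\<close> is a fibration and \<open>m\<close> a trivial
  cofibration, then \<open>p \<cdot> m\<close> is a weak equivalence exactly when \<open>p\<close> is a trivial fibration
  (\<open>W_comp_iff\<close>). Two factorizations of one map are dominated by a third, mapping
  to both by fibrations under the common domain; the span property makes these fibrations
  trivial, and 2-out-of-3 among fibrations transfers triviality from one factorization to the
  other.

  Second, given composable \<open>f\<close> and \<open>g\<close>, factor each. The composite consists of a trivial
  cofibration, a fibration \<open>r\<close>, a trivial cofibration \<open>n\<close> and a fibration, in this order.
  Extending \<open>r\<close> along \<open>n\<close> swaps the two middle maps, because the pullback of \<open>n\<close> along the
  extended fibration is a trivial cofibration by Frobenius. The extension is a trivial fibration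
  when \<open>r\<close> is one, and conversely because trivial fibrations are stable under pullback. Hence
  \<open>f\<close>, \<open>g\<close>, \<open>g \<cdot> f\<close> may be replaced by two fibrations and their composite
  (\<open>composable_pair_replaced_by_fibrations\<close>).

  The equalities \<open>F \<inter> W = TF\<close> and \<open>C \<inter> W = TC\<close> are instances of the retract argument, so the
  two given weak factorization systems are those of the model structure. For right
  properness, pull back the two factors of a weak equivalence one after the other: trivial
  fibrations are stable under every pullback, trivial cofibrations under pullback along
  fibrations by Frobenius.
\<close>

section \<open>Composition and pullbacks\<close>

context category
begin

lemma comp_Mor [simp]:
  "\<lbrakk>f \<in> Mor E; g \<in> Mor E; Cod E f = Dom E g\<rbrakk> \<Longrightarrow> g \<cdot> f \<in> Mor E"
  and Dom_comp [simp]: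
  "\<lbrakk>f \<in> Mor E; g \<in> Mor E; Cod E f = Dom E g\<rbrakk> \<Longrightarrow> Dom E (g \<cdot> f) = Dom E f"
  and Cod_comp [simp]:
  "\<lbrakk>f \<in> Mor E; g \<in> Mor E; Cod E f = Dom E g\<rbrakk> \<Longrightarrow> Cod E (g \<cdot> f) = Cod E g"
  using comp_hom[of f "Dom E f" "Dom E g" g "Cod E g"] by (auto simp: Hom_def)

lemma assoc:
  "\<lbrakk>f \<in> Mor E; g \<in> Mor E; h \<in> Mor E; Cod E f = Dom E g; Cod E g = Dom E h\<rbrakk>
    \<Longrightarrow> (h \<cdot> g) \<cdot> f = h \<cdot> (g \<cdot> f)"
  by (rule comp_assoc) (auto simp: Hom_def)

lemma Ident_Mor [simp]: "X \<in> Obj E \<Longrightarrow> Ident E X \<in> Mor E"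
  and Dom_Ident [simp]: "X \<in> Obj E \<Longrightarrow> Dom E (Ident E X) = X"
  and Cod_Ident [simp]: "X \<in> Obj E \<Longrightarrow> Cod E (Ident E X) = X"
  using ident_hom by (auto simp: Hom_def)

lemma comp_Ident_Dom [simp]: "f \<in> Mor E \<Longrightarrow> f \<cdot> Ident E (Dom E f) = f"
  and comp_Ident_Cod [simp]: "f \<in> Mor E \<Longrightarrow> Ident E (Cod E f) \<cdot> f = f"
  by (auto intro!: comp_ident_right comp_ident_left simp: Hom_def)

declare dom_obj [simp] cod_obj [simp]

end

lemma is_pullbackD:
  assumes "is_pullback E p q f g"
  shows "p \<in> Mor E" "q \<in> Mor E" "f \<in> Mor E" "g \<in> Mor E"
    "Dom E q = Dom E p" "Cod E p = Dom E f" "Cod E q = Dom E g" "Cod E g = Cod E f"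
    "f \<cdot>\<^bsub>E\<^esub> p = g \<cdot>\<^bsub>E\<^esub> q"
  using assms by (auto simp: is_pullback_def)

lemma is_pullback_universal:
  assumes "is_pullback E p q f g" "s \<in> Mor E" "t \<in> Mor E" "Dom E s = Dom E t"
    "Cod E s = Dom E f" "Cod E t = Dom E g" "f \<cdot>\<^bsub>E\<^esub> s = g \<cdot>\<^bsub>E\<^esub> t"
  obtains u where "u \<in> Mor E" "Dom E u = Dom E s" "Cod E u = Dom E p"
    "p \<cdot>\<^bsub>E\<^esub> u = s" "q \<cdot>\<^bsub>E\<^esub> u = t"
proof -
  have "s \<in> Hom E (Dom E s) (Dom E f)" "t \<in> Hom E (Dom E s) (Dom E g)"
    using assms by (auto simp: Hom_def)
  with assms obtain u where "u \<in> Hom E (Dom E s) (Dom E p)" "p \<cdot>\<^bsub>E\<^esub> u = s" "q \<cdot>\<^bsub>E\<^esub> u = t"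
    unfolding is_pullback_def by metis
  with that show thesis by (auto simp: Hom_def)
qed

lemma (in category) is_pullback_jointly_monic:
  assumes pb: "is_pullback E p q f g"
    and u: "u \<in> Mor E" "v \<in> Mor E" "Dom E u = Dom E v" "Cod E u = Dom E p" "Cod E v = Dom E p"
    and eq: "p \<cdot> u = p \<cdot> v" "q \<cdot> u = q \<cdot> v"
  shows "u = v"
proof -
  note [simp] = is_pullbackD[OF pb]
  have "p \<cdot> u \<in> Hom E (Dom E u) (Dom E f)" "q \<cdot> u \<in> Hom E (Dom E u) (Dom E g)"
    using u by (auto simp: Hom_def)
  moreover have "f \<cdot> (p \<cdot> u) = g \<cdot> (q \<cdot> u)"
    using u by (simp flip: assoc)
  ultimately have "\<exists>!w. w \<in> Hom E (Dom E u) (Dom E p) \<and> p \<cdot> w = p \<cdot> u \<and> q \<cdot> w = q \<cdot> u"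
    using pb unfolding is_pullback_def by blast
  moreover have "u \<in> Hom E (Dom E u) (Dom E p)" "v \<in> Hom E (Dom E u) (Dom E p)"
    using u by (auto simp: Hom_def)
  ultimately show ?thesis using eq by metis
qed

lemma (in category) is_pullbackI:
  assumes "p \<in> Mor E" "q \<in> Mor E" "f \<in> Mor E" "g \<in> Mor E"
    "Dom E q = Dom E p" "Cod E p = Dom E f" "Cod E q = Dom E g" "Cod E g = Cod E f"
    "f \<cdot> p = g \<cdot> q"
    and ex: "\<And>s t. \<lbrakk>s \<in> Mor E; t \<in> Mor E; Dom E s = Dom E t; Cod E s = Dom E f;
      Cod E t = Dom E g; f \<cdot> s = g \<cdot> t\<rbrakk> \<Longrightarrow>
      \<exists>u. u \<in> Mor E \<and> Dom E u = Dom E t \<and> Cod E u = Dom E p \<and> p \<cdot> u = s \<and> q \<cdot> u = t"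
    and uniq: "\<And>u v. \<lbrakk>u \<in> Mor E; v \<in> Mor E; Dom E u = Dom E v; Cod E u = Dom E p;
      Cod E v = Dom E p; p \<cdot> u = p \<cdot> v; q \<cdot> u = q \<cdot> v\<rbrakk> \<Longrightarrow> u = v"
  shows "is_pullback E p q f g"
  unfolding is_pullback_def
proof (intro conjI allI ballI impI)
  fix T s t
  assume st: "s \<in> Hom E T (Dom E f)" "t \<in> Hom E T (Dom E g)" "f \<cdot> s = g \<cdot> t"
  then obtain u where "u \<in> Mor E" "Dom E u = Dom E t" "Cod E u = Dom E p" "p \<cdot> u = s" "q \<cdot> u = t"
    using ex[of s t] by (auto simp: Hom_def)
  then show "\<exists>!u. u \<in> Hom E T (Dom E p) \<and> p \<cdot> u = s \<and> q \<cdot> u = t"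
    using st uniq by (intro ex1I[of _ u]) (auto simp: Hom_def)
qed (use assms in auto)

lemma (in category) is_pullback_sym:
  assumes pb: "is_pullback E p q f g"
  shows "is_pullback E q p g f"
proof (rule is_pullbackI)
  fix s t
  assume "s \<in> Mor E" "t \<in> Mor E" "Dom E s = Dom E t" "Cod E s = Dom E g" "Cod E t = Dom E f"
    "g \<cdot> s = f \<cdot> t"
  then show "\<exists>u. u \<in> Mor E \<and> Dom E u = Dom E t \<and> Cod E u = Dom E q \<and> q \<cdot> u = s \<and> p \<cdot> u = t"
    using is_pullback_universal[OF pb, of t s] is_pullbackD(5)[OF pb] by metis
next
  fix u v
  assume "u \<in> Mor E" "v \<in> Mor E" "Dom E u = Dom E v" "Cod E u = Dom E q" "Cod E v = Dom E q"
    "q \<cdot> u = q \<cdot> v" "p \<cdot> u = p \<cdot> v"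
  then show "u = v"
    using is_pullbackD(5)[OF pb] by - (rule is_pullback_jointly_monic[OF pb], auto)
qed (use is_pullbackD[OF pb] in auto)

text \<open>
  The half of the pasting lemma that cancels a pullback square: with \<open>g = t \<cdot> i\<close>, the pullback
  of \<open>g\<close> along \<open>f\<close> factors through the pullback of \<open>t\<close> along \<open>f\<close>, and the comparison is a
  pullback of \<open>i\<close>.
\<close>

lemma (in category) pullback_of_composite:
  assumes outer: "is_pullback E p q f (t \<cdot> i)" and right: "is_pullback E p' q' f t"
    and i: "i \<in> Mor E" "Cod E i = Dom E t"
  obtains u where "is_pullback E u q q' i" "Cod E u = Dom E p'" "p = p' \<cdot> u"
proof -
  note [simp] = is_pullbackD(1-8)[OF right] i is_pullbackD(1-3)[OF outer]
    is_pullbackD(5)[OF outer] is_pullbackD(6)[OF outer]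
  have [simp]: "Cod E q = Dom E i" using is_pullbackD(7)[OF outer] by simp
  have "f \<cdot> p = t \<cdot> (i \<cdot> q)"
    using is_pullbackD(9)[OF outer] by (simp add: assoc)
  then obtain u where u [simp]: "u \<in> Mor E" "Dom E u = Dom E p" "Cod E u = Dom E p'"
    and u_eq: "p' \<cdot> u = p" "q' \<cdot> u = i \<cdot> q"
    using is_pullback_universal[OF right, of p "i \<cdot> q"] by auto
  have "is_pullback E u q q' i"
  proof (rule is_pullbackI)
    fix s r
    assume s [simp]: "s \<in> Mor E" "r \<in> Mor E" "Dom E s = Dom E r" "Cod E s = Dom E q'"
      "Cod E r = Dom E i" and sr: "q' \<cdot> s = i \<cdot> r"
    have "f \<cdot> (p' \<cdot> s) = t \<cdot> (q' \<cdot> s)"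
      using is_pullbackD(9)[OF right] by (simp flip: assoc)
    then have "f \<cdot> (p' \<cdot> s) = (t \<cdot> i) \<cdot> r"
      by (simp add: sr assoc)
    then obtain w where w [simp]: "w \<in> Mor E" "Dom E w = Dom E r" "Cod E w = Dom E p"
      and w_eq: "p \<cdot> w = p' \<cdot> s" "q \<cdot> w = r"
      using is_pullback_universal[OF outer, of "p' \<cdot> s" r] by auto
    have "p' \<cdot> (u \<cdot> w) = p' \<cdot> s"
      using w_eq u_eq by (simp flip: assoc)
    moreover have "q' \<cdot> (u \<cdot> w) = (i \<cdot> q) \<cdot> w"
      using u_eq by (simp flip: assoc)
    then have "q' \<cdot> (u \<cdot> w) = q' \<cdot> s"
      using w_eq sr by (simp add: assoc)
    ultimately have "u \<cdot> w = s"
      by - (rule is_pullback_jointly_monic[OF right], auto)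
    moreover have "Cod E w = Dom E u" by simp
    ultimately show "\<exists>w. w \<in> Mor E \<and> Dom E w = Dom E r \<and> Cod E w = Dom E u \<and> u \<cdot> w = s \<and> q \<cdot> w = r"
      using w w_eq by blast
  next
    fix v w
    assume [simp]: "v \<in> Mor E" "w \<in> Mor E" "Dom E v = Dom E w" "Cod E v = Dom E u" "Cod E w = Dom E u"
      and eq: "u \<cdot> v = u \<cdot> w" "q \<cdot> v = q \<cdot> w"
    have "(p' \<cdot> u) \<cdot> v = (p' \<cdot> u) \<cdot> w"
      using eq(1) by (simp add: assoc)
    then have "p \<cdot> v = p \<cdot> w"
      unfolding u_eq .
    then show "v = w"
      using eq by - (rule is_pullback_jointly_monic[OF outer], auto)
  qed (use u_eq in auto)
  with that u u_eq show thesis by blast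
qed

text \<open>
  The objects of the shape are \<open>0\<close>, \<open>1\<close>, \<open>2\<close>, each standing for its own identity as well;
  the two other morphisms are \<open>3 : 0 \<rightarrow> 2\<close> and \<open>4 : 1 \<rightarrow> 2\<close>.
\<close>

definition cospan_shape :: "(nat, nat) cat" where
  "cospan_shape = \<lparr>Obj = {0, 1, 2}, Mor = {0, 1, 2, 3, 4},
     Dom = (\<lambda>k. if k = 3 then 0 else if k = 4 then 1 else k), Cod = (\<lambda>k. min k 2),
     Ident = (\<lambda>j. j), Comp = (\<lambda>l k. if l < 3 then k else l)\<rparr>"

lemma category_cospan_shape: "category cospan_shape"
  by unfold_locales (auto simp: cospan_shape_def Hom_def split: if_splits)

lemma (in category) pullback_exists:
  assumes lim: "finitely_complete E" and fg [simp]: "f \<in> Mor E" "g \<in> Mor E" "Cod E g = Cod E f"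
  obtains p q where "is_pullback E p q f g"
proof -
  define Do where "Do j = (if j = 0 then Dom E f else if j = 1 then Dom E g else Cod E f)" for j :: nat
  define Dm where "Dm k = (if k = 3 then f else if k = 4 then g else Ident E (Do k))" for k :: nat
  have Do [simp]: "Do 0 = Dom E f" "Do (Suc 0) = Dom E g" "Do 2 = Cod E f"
    and Dm [simp]: "Dm 0 = Ident E (Dom E f)" "Dm (Suc 0) = Ident E (Dom E g)"
      "Dm 2 = Ident E (Cod E f)" "Dm 3 = f" "Dm 4 = g"
    by (auto simp: Do_def Dm_def)
  have [simp]: "Ident E (Cod E f) \<cdot> g = g" using comp_Ident_Cod[of g] by simp
  have IdId: "Ident E X \<cdot> Ident E X = Ident E X" if "X \<in> Obj E" for X
    using comp_Ident_Dom[of "Ident E X"] that by simp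
  have "is_functor cospan_shape E Do Dm"
    unfolding is_functor_def using category_cospan_shape category_axioms
    by (auto simp: cospan_shape_def Hom_def IdId)
  moreover have "finite (Obj cospan_shape)" "finite (Mor cospan_shape)"
    by (auto simp: cospan_shape_def)
  ultimately obtain L c where L: "is_limit cospan_shape E Do Dm L c"
    using lim unfolding finitely_complete_def by blast
  have cone_iff: "is_cone cospan_shape E Do Dm X d \<longleftrightarrow>
      d 0 \<in> Hom E X (Dom E f) \<and> d 1 \<in> Hom E X (Dom E g) \<and> d 2 = f \<cdot> d 0 \<and> f \<cdot> d 0 = g \<cdot> d 1"
    for X d
  proof -
    have "X \<in> Obj E" if "d 0 \<in> Hom E X (Dom E f)"
      using that dom_obj by (auto simp: Hom_def)
    moreover have "f \<cdot> d 0 \<in> Hom E X (Cod E f)" if "d 0 \<in> Hom E X (Dom E f)"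
      using that by (auto simp: Hom_def)
    ultimately show ?thesis
      by (auto simp: is_cone_def cospan_shape_def intro: comp_ident_left)
  qed
  from L have c: "c 0 \<in> Hom E L (Dom E f)" "c 1 \<in> Hom E L (Dom E g)" "f \<cdot> c 0 = g \<cdot> c 1"
    and c2: "c 2 = f \<cdot> c 0"
    by (auto simp: is_limit_def cone_iff)
  have "is_pullback E (c 0) (c 1) f g"
    unfolding is_pullback_def
  proof (intro conjI allI ballI impI)
    fix T s t
    assume st: "s \<in> Hom E T (Dom E f)" "t \<in> Hom E T (Dom E g)" "f \<cdot> s = g \<cdot> t"
    define d where "d j = (if j = 0 then s else if j = 1 then t else f \<cdot> s)" for j :: nat
    have "is_cone cospan_shape E Do Dm T d"
      using st by (simp add: cone_iff d_def)
    then have "\<exists>!u. u \<in> Hom E T L \<and> (\<forall>j\<in>Obj cospan_shape. c j \<cdot> u = d j)"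
      using L unfolding is_limit_def by blast
    moreover have "(\<forall>j\<in>Obj cospan_shape. c j \<cdot> u = d j) \<longleftrightarrow> c 0 \<cdot> u = s \<and> c 1 \<cdot> u = t"
      if "u \<in> Hom E T L" for u
      using that c st(3) by (auto simp: cospan_shape_def d_def c2 Hom_def assoc)
    moreover have "Dom E (c 0) = L" using c by (simp add: Hom_def)
    ultimately show "\<exists>!u. u \<in> Hom E T (Dom E (c 0)) \<and> c 0 \<cdot> u = s \<and> c 1 \<cdot> u = t"
      by (metis (no_types, lifting))
  qed (use c in \<open>auto simp: Hom_def\<close>)
  with that show thesis by blast
qed


section \<open>Weak factorization systems\<close>

locale wfs = category +
  fixes L R :: "'m set"
  assumes wfs: "weak_factorization_system E L R"
begin

lemma left_Mor [simp]: "i \<in> L \<Longrightarrow> i \<in> Mor E"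
  and right_Mor [simp]: "p \<in> R \<Longrightarrow> p \<in> Mor E"
  using wfs unfolding weak_factorization_system_def left_lifting_class_def right_lifting_class_def
  by blast+

lemma lifts: "i \<in> L \<Longrightarrow> p \<in> R \<Longrightarrow> lifts_against E i p"
  using wfs unfolding weak_factorization_system_def left_lifting_class_def by blast

lemma lift:
  assumes "i \<in> L" "p \<in> R" "u \<in> Mor E" "v \<in> Mor E" "Dom E u = Dom E i" "Cod E u = Dom E p"
    "Dom E v = Cod E i" "Cod E v = Cod E p" "p \<cdot> u = v \<cdot> i"
  obtains h where "h \<in> Mor E" "Dom E h = Cod E i" "Cod E h = Dom E p" "h \<cdot> i = u" "p \<cdot> h = v"
  using lifts[OF assms(1,2)] assms that unfolding lifts_against_def Hom_def by auto

lemma factor: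
  assumes "f \<in> Mor E"
  obtains i p where "i \<in> L" "p \<in> R" "Cod E i = Dom E p" "f = p \<cdot> i"
  using assms wfs unfolding weak_factorization_system_def factor_class_def by blast

lemma leftI:
  assumes "i \<in> Mor E"
    and "\<And>p u v. \<lbrakk>p \<in> R; u \<in> Mor E; v \<in> Mor E; Dom E u = Dom E i; Cod E u = Dom E p;
      Dom E v = Cod E i; Cod E v = Cod E p; p \<cdot> u = v \<cdot> i\<rbrakk> \<Longrightarrow>
      \<exists>h \<in> Mor E. Dom E h = Cod E i \<and> Cod E h = Dom E p \<and> h \<cdot> i = u \<and> p \<cdot> h = v"
  shows "i \<in> L"
proof -
  have "lifts_against E i p" if "p \<in> R" for p
    unfolding lifts_against_def Hom_def using assms(2)[OF that] by fastforce
  then have "i \<in> left_lifting_class E R"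
    using assms(1) by (simp add: left_lifting_class_def)
  then show ?thesis
    using wfs unfolding weak_factorization_system_def by blast
qed

lemma rightI:
  assumes "p \<in> Mor E"
    and "\<And>i u v. \<lbrakk>i \<in> L; u \<in> Mor E; v \<in> Mor E; Dom E u = Dom E i; Cod E u = Dom E p;
      Dom E v = Cod E i; Cod E v = Cod E p; p \<cdot> u = v \<cdot> i\<rbrakk> \<Longrightarrow>
      \<exists>h \<in> Mor E. Dom E h = Cod E i \<and> Cod E h = Dom E p \<and> h \<cdot> i = u \<and> p \<cdot> h = v"
  shows "p \<in> R"
proof -
  have "lifts_against E i p" if "i \<in> L" for i
    unfolding lifts_against_def Hom_def using assms(2)[OF that] by fastforce
  then have "p \<in> right_lifting_class E L"
    using assms(1) by (simp add: right_lifting_class_def)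
  then show ?thesis
    using wfs unfolding weak_factorization_system_def by blast
qed

lemma Ident_left: "X \<in> Obj E \<Longrightarrow> Ident E X \<in> L"
proof (rule leftI)
  fix p u v
  assume "X \<in> Obj E" and u: "u \<in> Mor E" "Dom E u = Dom E (Ident E X)" "Cod E u = Dom E p"
    and v: "v \<in> Mor E" "Dom E v = Cod E (Ident E X)" "p \<cdot> u = v \<cdot> Ident E X"
  then show "\<exists>h\<in>Mor E. Dom E h = Cod E (Ident E X) \<and> Cod E h = Dom E p
      \<and> h \<cdot> Ident E X = u \<and> p \<cdot> h = v"
    using comp_Ident_Dom[of u] comp_Ident_Dom[of v] by (intro bexI[of _ u]) auto
qed simp

lemma Ident_right: "X \<in> Obj E \<Longrightarrow> Ident E X \<in> R"
proof (rule rightI)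
  fix i u v
  assume "X \<in> Obj E" and u: "u \<in> Mor E" "Cod E u = Dom E (Ident E X)" "Ident E X \<cdot> u = v \<cdot> i"
    and v: "v \<in> Mor E" "Dom E v = Cod E i" "Cod E v = Cod E (Ident E X)"
  then show "\<exists>h\<in>Mor E. Dom E h = Cod E i \<and> Cod E h = Dom E (Ident E X)
      \<and> h \<cdot> i = u \<and> Ident E X \<cdot> h = v"
    using comp_Ident_Cod[of u] comp_Ident_Cod[of v] by (intro bexI[of _ v]) auto
qed simp

lemma left_comp:
  assumes "i \<in> L" "j \<in> L" and [simp]: "Cod E i = Dom E j"
  shows "j \<cdot> i \<in> L"
proof (rule leftI)
  note [simp] = left_Mor[OF assms(1)] left_Mor[OF assms(2)]
  show "j \<cdot> i \<in> Mor E" by simp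
  fix p u v
  assume p: "p \<in> R" and "u \<in> Mor E" "v \<in> Mor E" "Dom E u = Dom E (j \<cdot> i)"
    "Cod E u = Dom E p" "Dom E v = Cod E (j \<cdot> i)" "Cod E v = Cod E p"
    and sq: "p \<cdot> u = v \<cdot> (j \<cdot> i)"
  then have [simp]: "p \<in> Mor E" "u \<in> Mor E" "v \<in> Mor E" "Dom E u = Dom E i"
    "Cod E u = Dom E p" "Dom E v = Cod E j" "Cod E v = Cod E p" by auto
  from sq have "p \<cdot> u = (v \<cdot> j) \<cdot> i" by (simp add: assoc)
  then obtain k where [simp]: "k \<in> Mor E" "Dom E k = Dom E j" "Cod E k = Dom E p"
    and k: "k \<cdot> i = u" "p \<cdot> k = v \<cdot> j"
    using lift[OF assms(1) p, of u "v \<cdot> j"] by auto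
  obtain h where [simp]: "h \<in> Mor E" "Dom E h = Cod E j" "Cod E h = Dom E p"
    and h: "h \<cdot> j = k" "p \<cdot> h = v"
    using lift[OF assms(2) p, of k v] k by auto
  have "h \<cdot> (j \<cdot> i) = u" using h k by (simp flip: assoc)
  with h show "\<exists>h\<in>Mor E. Dom E h = Cod E (j \<cdot> i) \<and> Cod E h = Dom E p \<and> h \<cdot> (j \<cdot> i) = u \<and> p \<cdot> h = v"
    by (intro bexI[of _ h]) auto
qed

lemma right_comp:
  assumes "p \<in> R" "q \<in> R" and [simp]: "Cod E p = Dom E q"
  shows "q \<cdot> p \<in> R"
proof (rule rightI)
  note [simp] = right_Mor[OF assms(1)] right_Mor[OF assms(2)]
  show "q \<cdot> p \<in> Mor E" by simp
  fix i u v
  assume i: "i \<in> L" and "u \<in> Mor E" "v \<in> Mor E" "Dom E u = Dom E i"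
    "Cod E u = Dom E (q \<cdot> p)" "Dom E v = Cod E i" "Cod E v = Cod E (q \<cdot> p)"
    and sq: "(q \<cdot> p) \<cdot> u = v \<cdot> i"
  then have [simp]: "i \<in> Mor E" "u \<in> Mor E" "v \<in> Mor E" "Dom E u = Dom E i"
    "Cod E u = Dom E p" "Dom E v = Cod E i" "Cod E v = Cod E q" by auto
  from sq have "q \<cdot> (p \<cdot> u) = v \<cdot> i" by (simp add: assoc)
  then obtain k where [simp]: "k \<in> Mor E" "Dom E k = Cod E i" "Cod E k = Dom E q"
    and k: "k \<cdot> i = p \<cdot> u" "q \<cdot> k = v"
    using lift[OF i assms(2), of "p \<cdot> u" v] by auto
  obtain h where [simp]: "h \<in> Mor E" "Dom E h = Cod E i" "Cod E h = Dom E p"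
    and h: "h \<cdot> i = u" "p \<cdot> h = k"
    using lift[OF i assms(1), of u k] k by auto
  have "(q \<cdot> p) \<cdot> h = v" using h k by (simp add: assoc)
  with h show "\<exists>h\<in>Mor E. Dom E h = Cod E i \<and> Cod E h = Dom E (q \<cdot> p) \<and> h \<cdot> i = u \<and> (q \<cdot> p) \<cdot> h = v"
    by (intro bexI[of _ h]) auto
qed

lemma right_pullback:
  assumes pb: "is_pullback E p q f g" and g: "g \<in> R"
  shows "p \<in> R"
proof (rule rightI)
  note [simp] = is_pullbackD(1-8)[OF pb]
  show "p \<in> Mor E" by simp
  fix i u v
  assume i: "i \<in> L" and [simp]: "u \<in> Mor E" "v \<in> Mor E" "Dom E u = Dom E i"
    "Cod E u = Dom E p" "Dom E v = Cod E i" "Cod E v = Cod E p"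
    and sq: "p \<cdot> u = v \<cdot> i"
  have [simp]: "i \<in> Mor E" using i by simp
  have "g \<cdot> (q \<cdot> u) = f \<cdot> (p \<cdot> u)"
    using is_pullbackD(9)[OF pb] by (simp flip: assoc)
  then have "g \<cdot> (q \<cdot> u) = (f \<cdot> v) \<cdot> i" by (simp add: sq assoc)
  then obtain k where [simp]: "k \<in> Mor E" "Dom E k = Cod E i" "Cod E k = Dom E g"
    and k: "k \<cdot> i = q \<cdot> u" "g \<cdot> k = f \<cdot> v"
    using lift[OF i g, of "q \<cdot> u" "f \<cdot> v"] by auto
  obtain h where [simp]: "h \<in> Mor E" "Dom E h = Cod E i" "Cod E h = Dom E p"
    and h: "p \<cdot> h = v" "q \<cdot> h = k"
    using is_pullback_universal[OF pb, of v k] k by auto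
  have "p \<cdot> (h \<cdot> i) = p \<cdot> u" "q \<cdot> (h \<cdot> i) = q \<cdot> u"
    using h k sq by (simp_all flip: assoc)
  then have "h \<cdot> i = u"
    by - (rule is_pullback_jointly_monic[OF pb], auto)
  with h show "\<exists>h\<in>Mor E. Dom E h = Cod E i \<and> Cod E h = Dom E p \<and> h \<cdot> i = u \<and> p \<cdot> h = v"
    by (intro bexI[of _ h]) auto
qed

text \<open>
  The retract argument: lifting \<open>t \<cdot> i\<close> against \<open>t\<close> yields a section of \<open>t\<close> that exhibits
  \<open>t \<cdot> i\<close> as a retract of \<open>i\<close>.
\<close>

lemma left_retract_argument:
  assumes i: "i \<in> L" and t [simp]: "t \<in> Mor E" "Cod E i = Dom E t"
    and lifts: "lifts_against E (t \<cdot> i) t"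
  shows "t \<cdot> i \<in> L"
proof (rule leftI)
  note [simp] = left_Mor[OF i]
  show "t \<cdot> i \<in> Mor E" by simp
  have "t \<cdot> i = Ident E (Cod E t) \<cdot> (t \<cdot> i)"
    using comp_Ident_Cod[of "t \<cdot> i"] by simp
  then obtain h where [simp]: "h \<in> Mor E" "Dom E h = Cod E t" "Cod E h = Dom E t"
    and h: "h \<cdot> (t \<cdot> i) = i" "t \<cdot> h = Ident E (Cod E t)"
    using lifts[unfolded lifts_against_def, THEN bspec[of _ _ i],
      THEN bspec[of _ _ "Ident E (Cod E t)"]] by (auto simp: Hom_def)
  fix r u v
  assume r: "r \<in> R" and "u \<in> Mor E" "v \<in> Mor E" "Dom E u = Dom E (t \<cdot> i)"
    "Cod E u = Dom E r" "Dom E v = Cod E (t \<cdot> i)" "Cod E v = Cod E r"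
    and sq: "r \<cdot> u = v \<cdot> (t \<cdot> i)"
  then have [simp]: "r \<in> Mor E" "u \<in> Mor E" "v \<in> Mor E" "Dom E u = Dom E i"
    "Cod E u = Dom E r" "Dom E v = Cod E t" "Cod E v = Cod E r" by auto
  from sq have "r \<cdot> u = (v \<cdot> t) \<cdot> i" by (simp add: assoc)
  then obtain k where [simp]: "k \<in> Mor E" "Dom E k = Dom E t" "Cod E k = Dom E r"
    and k: "k \<cdot> i = u" "r \<cdot> k = v \<cdot> t"
    using lift[OF i r, of u "v \<cdot> t"] by auto
  have "(k \<cdot> h) \<cdot> (t \<cdot> i) = u"
    using h k by (simp add: assoc)
  moreover have "r \<cdot> (k \<cdot> h) = (v \<cdot> t) \<cdot> h"
    using k by (simp flip: assoc)
  then have "r \<cdot> (k \<cdot> h) = v"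
    using h comp_Ident_Dom[of v] by (simp add: assoc)
  ultimately show "\<exists>h\<in>Mor E. Dom E h = Cod E (t \<cdot> i) \<and> Cod E h = Dom E r
      \<and> h \<cdot> (t \<cdot> i) = u \<and> r \<cdot> h = v"
    by (intro bexI[of _ "k \<cdot> h"]) auto
qed

text \<open>
  Dually, lifting \<open>i\<close> against \<open>t \<cdot> i\<close> yields a retraction of \<open>i\<close> that exhibits \<open>t \<cdot> i\<close> as a
  retract of \<open>t\<close>.
\<close>

lemma right_retract_argument:
  assumes t: "t \<in> R" and i [simp]: "i \<in> Mor E" "Cod E i = Dom E t"
    and lifts: "lifts_against E i (t \<cdot> i)"
  shows "t \<cdot> i \<in> R"
proof (rule rightI)
  note [simp] = right_Mor[OF t]
  show "t \<cdot> i \<in> Mor E" by simp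
  have "(t \<cdot> i) \<cdot> Ident E (Dom E i) = t \<cdot> i"
    using comp_Ident_Dom[of "t \<cdot> i"] by simp
  then obtain h where [simp]: "h \<in> Mor E" "Dom E h = Dom E t" "Cod E h = Dom E i"
    and h: "(t \<cdot> i) \<cdot> h = t" "h \<cdot> i = Ident E (Dom E i)"
    using lifts[unfolded lifts_against_def, THEN bspec[of _ _ "Ident E (Dom E i)"],
      THEN bspec[of _ _ t]] by (auto simp: Hom_def)
  fix l u v
  assume l: "l \<in> L" and "u \<in> Mor E" "v \<in> Mor E" "Dom E u = Dom E l"
    "Cod E u = Dom E (t \<cdot> i)" "Dom E v = Cod E l" "Cod E v = Cod E (t \<cdot> i)"
    and sq: "(t \<cdot> i) \<cdot> u = v \<cdot> l"
  then have [simp]: "l \<in> Mor E" "u \<in> Mor E" "v \<in> Mor E" "Dom E u = Dom E l"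
    "Cod E u = Dom E i" "Dom E v = Cod E l" "Cod E v = Cod E t" by auto
  from sq have "t \<cdot> (i \<cdot> u) = v \<cdot> l" by (simp add: assoc)
  then obtain k where [simp]: "k \<in> Mor E" "Dom E k = Cod E l" "Cod E k = Dom E t"
    and k: "k \<cdot> l = i \<cdot> u" "t \<cdot> k = v"
    using lift[OF l t, of "i \<cdot> u" v] by auto
  have "(t \<cdot> i) \<cdot> (h \<cdot> k) = ((t \<cdot> i) \<cdot> h) \<cdot> k"
    by (rule assoc[symmetric]) auto
  then have "(t \<cdot> i) \<cdot> (h \<cdot> k) = v"
    using h k by simp
  moreover have "(h \<cdot> k) \<cdot> l = (h \<cdot> i) \<cdot> u"
    using k by (simp add: assoc)
  then have "(h \<cdot> k) \<cdot> l = u"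
    using h comp_Ident_Cod[of u] by simp
  ultimately show "\<exists>h\<in>Mor E. Dom E h = Cod E l \<and> Cod E h = Dom E (t \<cdot> i)
      \<and> h \<cdot> l = u \<and> (t \<cdot> i) \<cdot> h = v"
    by (intro bexI[of _ "h \<cdot> k"]) auto
qed

end


section \<open>Weak equivalences\<close>

locale premodel = category +
  fixes C TF TC F W :: "'m set"
  assumes lim: "finitely_complete E"
    and cof_wfs: "weak_factorization_system E C TF"
    and fib_wfs: "weak_factorization_system E TC F"
    and TC_C: "TC \<subseteq> C"
    and W_def: "W = factor_class E TC TF"
begin

sublocale cof: wfs E C TF
  by unfold_locales (rule cof_wfs)

sublocale fib: wfs E TC F
  by unfold_locales (rule fib_wfs)

lemma TF_F: "TF \<subseteq> F"
  using cof_wfs fib_wfs TC_C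
  unfolding weak_factorization_system_def right_lifting_class_def by blast

lemma W_iff: "f \<in> W \<longleftrightarrow> (\<exists>i \<in> TC. \<exists>p \<in> TF. Cod E i = Dom E p \<and> f = p \<cdot> i)"
proof
  assume "f \<in> W"
  then show "\<exists>i \<in> TC. \<exists>p \<in> TF. Cod E i = Dom E p \<and> f = p \<cdot> i"
    unfolding W_def factor_class_def by blast
next
  assume "\<exists>i \<in> TC. \<exists>p \<in> TF. Cod E i = Dom E p \<and> f = p \<cdot> i"
  then obtain i p where "i \<in> TC \<inter> Mor E" "p \<in> TF \<inter> Mor E" "Cod E i = Dom E p" "f = p \<cdot> i"
    using fib.left_Mor cof.right_Mor by blast
  moreover from this have "f \<in> Mor E" by simp
  ultimately show "f \<in> W"
    unfolding W_def factor_class_def by blast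
qed

text \<open>
  A fibration lifts against the trivial cofibration in its own factorization, so the retract
  argument makes it a retract of the trivial fibration. The other inclusion takes an identity for
  the missing factor; the proof for cofibrations below is dual.
\<close>

lemma F_W: "F \<inter> W = TF"
proof (intro equalityI subsetI)
  fix f assume f: "f \<in> F \<inter> W"
  then obtain i p where ip: "i \<in> TC" "p \<in> TF" "Cod E i = Dom E p" "f = p \<cdot> i"
    by (auto simp: W_iff)
  have "lifts_against E i f"
    using f ip fib.lifts by blast
  then show "f \<in> TF"
    using cof.right_retract_argument[of p i] ip by simp
next
  fix f assume f: "f \<in> TF"
  then have "f \<cdot> Ident E (Dom E f) = f" "Ident E (Dom E f) \<in> TC"
    "Cod E (Ident E (Dom E f)) = Dom E f"
    using fib.Ident_left by auto
  then have "f \<in> W" using f unfolding W_iff by metis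
  then show "f \<in> F \<inter> W" using f TF_F by blast
qed

lemma C_W: "C \<inter> W = TC"
proof (intro equalityI subsetI)
  fix f assume f: "f \<in> C \<inter> W"
  then obtain i p where ip: "i \<in> TC" "p \<in> TF" "Cod E i = Dom E p" "f = p \<cdot> i"
    by (auto simp: W_iff)
  have "lifts_against E f p"
    using f ip cof.lifts by blast
  then show "f \<in> TC"
    using fib.left_retract_argument[of i p] ip by simp
next
  fix f assume f: "f \<in> TC"
  then have "Ident E (Cod E f) \<cdot> f = f" "Ident E (Cod E f) \<in> TF"
    "Dom E (Ident E (Cod E f)) = Cod E f"
    using cof.Ident_right by auto
  then have "f \<in> W" using f unfolding W_iff by metis
  then show "f \<in> C \<inter> W" using f TC_C by blast
qed

text \<open>
  Membership in \<open>W\<close> asserts that some factorization ends in a trivial fibration; here every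
  factorization into a trivial cofibration and a fibration does. To compare the factorization
  \<open>p \<cdot> m\<close> with \<open>t \<cdot> i\<close>, where \<open>t\<close> is a trivial fibration, factor the map \<open>(m, i)\<close> into the fibre
  product of the middle objects as a trivial cofibration followed by a fibration. The object in
  the middle of it has fibrations to both middle objects, which are trivial by the span property,
  so the two fibrations \<open>p\<close> and \<open>t\<close> become equal after composition with trivial fibrations.
\<close>

lemma W_comp_iff:
  assumes span: "span_property E TC F TF" and rel: "two_out_of_three_relative E TF F"
    and m: "m \<in> TC" and p: "p \<in> F" and mp [simp]: "Cod E m = Dom E p"
  shows "p \<cdot> m \<in> W \<longleftrightarrow> p \<in> TF"
proof
  assume "p \<in> TF"
  with m mp show "p \<cdot> m \<in> W" unfolding W_iff by blast
next
  assume "p \<cdot> m \<in> W"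
  then obtain i t where i: "i \<in> TC" and t: "t \<in> TF" and it [simp]: "Cod E i = Dom E t"
    and eq: "p \<cdot> m = t \<cdot> i"
    by (auto simp: W_iff)
  have [simp]: "m \<in> Mor E" "p \<in> Mor E" "i \<in> Mor E" "t \<in> Mor E"
    using m p i t by auto
  have "Cod E (p \<cdot> m) = Cod E (t \<cdot> i)" "Dom E (p \<cdot> m) = Dom E (t \<cdot> i)"
    using eq by simp_all
  then have [simp]: "Cod E t = Cod E p" "Dom E i = Dom E m" by auto
  obtain x y where pb: "is_pullback E x y p t"
    using pullback_exists[OF lim, of p t] by auto
  note [simp] = is_pullbackD(1-8)[OF pb]
  obtain w where [simp]: "w \<in> Mor E" "Dom E w = Dom E m" "Cod E w = Dom E x"
    and w: "x \<cdot> w = m" "y \<cdot> w = i"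
    using is_pullback_universal[OF pb, of m i] eq by auto
  obtain n r where n: "n \<in> TC" and r: "r \<in> F" and nr [simp]: "Cod E n = Dom E r" and wnr: "w = r \<cdot> n"
    using fib.factor[of w] by auto
  have [simp]: "n \<in> Mor E" "r \<in> Mor E" using n r by auto
  have [simp]: "Dom E n = Dom E m" "Cod E r = Dom E x"
    using \<open>Dom E w = Dom E m\<close> \<open>Cod E w = Dom E x\<close> unfolding wnr by auto
  have x: "x \<in> F"
    using fib.right_pullback[OF pb] t TF_F by blast
  have y: "y \<in> F"
    using fib.right_pullback[OF is_pullback_sym[OF pb]] p by blast
  have xr: "x \<cdot> r \<in> F" and yr: "y \<cdot> r \<in> F"
    using x y r by (auto intro: fib.right_comp)
  have spanD: "z \<in> TF" if "z \<in> F" "Dom E z = Cod E n" "z \<cdot> n \<in> TC" for z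
  proof -
    have "z \<in> F \<inter> Hom E (Cod E n) (Cod E z)" "n \<in> TC \<inter> Hom E (Dom E n) (Cod E n)"
      "z \<cdot> n \<in> TC \<inter> Hom E (Dom E n) (Cod E z)"
      using that n by (auto simp: Hom_def)
    with span show ?thesis unfolding span_property_def by blast
  qed
  have "(x \<cdot> r) \<cdot> n = m" "(y \<cdot> r) \<cdot> n = i"
    using w by (auto simp: wnr assoc)
  then have xr_TF: "x \<cdot> r \<in> TF" and yr_TF: "y \<cdot> r \<in> TF"
    using m i by (auto intro!: spanD xr yr)
  have "p \<cdot> (x \<cdot> r) = t \<cdot> (y \<cdot> r)"
    using is_pullbackD(9)[OF pb] by (simp flip: assoc)
  moreover have "t \<cdot> (y \<cdot> r) \<in> TF"
    by (rule cof.right_comp) (use t yr_TF in auto)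
  ultimately have "p \<cdot> (x \<cdot> r) \<in> TF" by simp
  moreover have "Cod E (x \<cdot> r) = Dom E p" by simp
  ultimately show "p \<in> TF"
    using rel p xr xr_TF unfolding two_out_of_three_relative_def by blast
qed

text \<open>
  Pull back the trivial fibration \<open>t\<close> of a factorization \<open>t \<cdot> i\<close> first. The trivial cofibration
  \<open>i\<close> is then pulled back along a projection \<open>q'\<close>, which is a fibration as a pullback of \<open>f\<close>, so
  the Frobenius property applies.
\<close>

lemma right_proper:
  assumes frob: "frobenius_property E TC F"
  shows "stable_under_pullback_along E W F"
  unfolding stable_under_pullback_along_def
proof (intro allI impI)
  fix p q f g
  assume "is_pullback E p q f g \<and> f \<in> F \<and> g \<in> W"
  then obtain i t where pb: "is_pullback E p q f (t \<cdot> i)" and f: "f \<in> F"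
    and i: "i \<in> TC" and t: "t \<in> TF" and it: "Cod E i = Dom E t"
    by (auto simp: W_iff)
  have "Cod E t = Cod E f"
    using is_pullbackD(8)[OF pb] i t it by simp
  then obtain p' q' where pb': "is_pullback E p' q' f t"
    using pullback_exists[OF lim, of f t] f t by auto
  obtain u where u: "is_pullback E u q q' i" "Cod E u = Dom E p'" "p = p' \<cdot> u"
    using pullback_of_composite[OF pb pb' _ it] i by auto
  have "q' \<in> F"
    using fib.right_pullback[OF is_pullback_sym[OF pb']] f by blast
  then have "u \<in> TC"
    using frob u i unfolding frobenius_property_def stable_under_pullback_along_def by blast
  moreover have "p' \<in> TF"
    using cof.right_pullback[OF pb'] t by blast
  ultimately show "p \<in> W"
    using u unfolding W_iff by blast
qed

text \<open>
  Write \<open>f = r \<cdot> m\<close> and \<open>g = q \<cdot> n\<close> with trivial cofibrations \<open>m\<close>, \<open>n\<close> and fibrations \<open>r\<close>, \<open>q\<close>.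
  Extending \<open>r\<close> along \<open>n\<close> to a fibration \<open>p\<close> exchanges the two middle maps in
  \<open>q \<cdot> n \<cdot> r \<cdot> m\<close>: this composite is \<open>q \<cdot> p \<cdot> k \<cdot> m\<close>, where \<open>k\<close> is a trivial cofibration by the
  Frobenius property. Thus weak equivalences among \<open>f\<close>, \<open>g\<close>, \<open>g \<cdot> f\<close> are trivial fibrations among
  \<open>p\<close>, \<open>q\<close>, \<open>q \<cdot> p\<close>.
\<close>

lemma composable_pair_replaced_by_fibrations:
  assumes span: "span_property E TC F TF" and rel: "two_out_of_three_relative E TF F"
    and ext_F: "extends_along E F TC" and ext_TF: "extends_along E TF TC"
    and frob: "frobenius_property E TC F"
    and fg [simp]: "f \<in> Mor E" "g \<in> Mor E" "Cod E f = Dom E g"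
  obtains p q where "p \<in> F" "q \<in> F" "Cod E p = Dom E q"
    "f \<in> W \<longleftrightarrow> p \<in> TF" "g \<in> W \<longleftrightarrow> q \<in> TF" "g \<cdot> f \<in> W \<longleftrightarrow> q \<cdot> p \<in> TF"
proof -
  note W_comp_iff = W_comp_iff[OF span rel]
  obtain m r where m: "m \<in> TC" and r: "r \<in> F" and mr [simp]: "Cod E m = Dom E r" and f: "f = r \<cdot> m"
    using fib.factor[of f] by auto
  obtain n q where n: "n \<in> TC" and q: "q \<in> F" and nq [simp]: "Cod E n = Dom E q" and g: "g = q \<cdot> n"
    using fib.factor[of g] by auto
  have [simp]: "m \<in> Mor E" "r \<in> Mor E" "n \<in> Mor E" "q \<in> Mor E"
    using m r n q by auto
  have [simp]: "Cod E r = Dom E n"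
    using \<open>Cod E f = Dom E g\<close> unfolding f g by simp
  \<comment> \<open>Extending a trivial fibration merely as a fibration gives no control over whether the result
    is trivial, so the two cases use different extension hypotheses.\<close>
  obtain p k where p: "p \<in> F" and pb: "is_pullback E k r p n" and r_p: "r \<in> TF \<Longrightarrow> p \<in> TF"
  proof (cases "r \<in> TF")
    case True
    moreover have "r \<in> Hom E (Dom E r) (Dom E n)" "n \<in> Hom E (Dom E n) (Cod E n)"
      by (auto simp: Hom_def)
    ultimately obtain p k where "p \<in> TF" "is_pullback E k r p n"
      using ext_TF n unfolding extends_along_def by blast
    with TF_F that show thesis by blast
  next
    case False
    moreover have "r \<in> Hom E (Dom E r) (Dom E n)" "n \<in> Hom E (Dom E n) (Cod E n)"
      by (auto simp: Hom_def)
    ultimately obtain p k where "p \<in> F" "is_pullback E k r p n"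
      using ext_F n r unfolding extends_along_def by blast
    with False that show thesis by blast
  qed
  note [simp] = is_pullbackD(1,3,6)[OF pb]
  have [simp]: "Dom E k = Dom E r" "Cod E p = Dom E q"
    using is_pullbackD(5,8)[OF pb] by auto
  have pk: "p \<cdot> k = n \<cdot> r"
    using is_pullbackD(9)[OF pb] .
  have "k \<in> TC"
    using frob pb p n unfolding frobenius_property_def stable_under_pullback_along_def by blast
  then have km: "k \<cdot> m \<in> TC"
    using m by (intro fib.left_comp) auto
  have qp: "q \<cdot> p \<in> F"
    using p q by (intro fib.right_comp) auto
  have "f \<in> W \<longleftrightarrow> r \<in> TF"
    unfolding f using W_comp_iff m r by simp
  moreover have "r \<in> TF \<longleftrightarrow> p \<in> TF"
    using cof.right_pullback[OF is_pullback_sym[OF pb]] r_p by blast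
  moreover have "g \<in> W \<longleftrightarrow> q \<in> TF"
    unfolding g using W_comp_iff n q by simp
  moreover have "g \<cdot> f = q \<cdot> ((n \<cdot> r) \<cdot> m)"
    unfolding f g by (simp add: assoc)
  then have "g \<cdot> f = (q \<cdot> p) \<cdot> (k \<cdot> m)"
    unfolding pk[symmetric] by (simp add: assoc)
  then have "g \<cdot> f \<in> W \<longleftrightarrow> q \<cdot> p \<in> TF"
    using W_comp_iff[OF km qp] by simp
  ultimately show thesis
    using that[OF p q] by simp
qed

lemma two_out_of_three_W:
  assumes span: "span_property E TC F TF" and rel: "two_out_of_three_relative E TF F"
    and ext: "extends_along E F TC" "extends_along E TF TC"
    and frob: "frobenius_property E TC F"
  shows "two_out_of_three E W"
  unfolding two_out_of_three_relative_def
proof (intro ballI impI)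
  fix f g
  assume "f \<in> Mor E" "g \<in> Mor E" "Cod E f = Dom E g"
  from composable_pair_replaced_by_fibrations[OF assms this]
  obtain p q where "p \<in> F" "q \<in> F" "Cod E p = Dom E q"
    and iff: "f \<in> W \<longleftrightarrow> p \<in> TF" "g \<in> W \<longleftrightarrow> q \<in> TF" "g \<cdot> f \<in> W \<longleftrightarrow> q \<cdot> p \<in> TF" .
  with rel show "(f \<in> W \<and> g \<in> W \<longrightarrow> g \<cdot> f \<in> W) \<and> (f \<in> W \<and> g \<cdot> f \<in> W \<longrightarrow> g \<in> W) \<and>
      (g \<in> W \<and> g \<cdot> f \<in> W \<longrightarrow> f \<in> W)"
    unfolding two_out_of_three_relative_def iff by blast
qed

end

theorem theorem2p8:
  fixes E :: "('o, 'm) cat"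
    and C TF TC F W :: "'m set"
  assumes "category E"
    and "finitely_complete E"
    and "finitely_cocomplete E"
    and "weak_factorization_system E C TF"
    and "weak_factorization_system E TC F"
    and "TC \<subseteq> C"
    and "W = factor_class E TC TF"
    and "span_property E TC F TF"
    and "two_out_of_three_relative E TF F"
    and "extends_along E F TC"
    and "extends_along E TF TC"
    and "frobenius_property E TC F"
  shows "right_proper_model_structure E C W F"
proof -
  interpret premodel E C TF TC F W
    using assms by (simp add: premodel_def premodel_axioms_def)
  have "C \<subseteq> Mor E" "F \<subseteq> Mor E" "W \<subseteq> Mor E"
    unfolding W_def factor_class_def by auto
  then show ?thesis
    unfolding right_proper_model_structure_def model_structure_def F_W C_W
    using cof_wfs fib_wfs two_out_of_three_W[OF assms(8-12)] right_proper[OF assms(12)] by blast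
qed

end
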